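(* Let $L$ be a finite-dimensional Lie algebra of derived length $2$ over an algebraically closed field $\mathbb{F}$ of prime characteristic $p$ such that $\dim(L/L')=1$. Let $x\in L\setminus L'$ and assume that $x$ induces (via $v\mapsto [x,v]$) a non-singular endomorphism of finite order on $L'$. Then $L$ has a non-singular derivation of finite order if, and only if, $L'$ can be written as a direct sum of $(x,p)$-cyclic modules.
   Context: $L'=[L,L]$; derived length $2$ means $L'\neq 0$ and $[L',L']=0$. A linear map is non-singular if it is invertible, and an invertible linear map $\alpha$ has finite order if $\alpha^n=\mathrm{id}$ for some $n\ge 1$. The abelian ideal $L'$ is a module for the one-dimensional Lie algebra $\langle x\rangle$, with $x$ acting by $v\mapsto [x,v]$; the modules in the direct sum are $\langle x\rangle$-submodules of $L'$. Let $V$ be a finite-dimensional vector space over a field $\mathbb{F}$ of prime characteristic $p$, and let $x$ act on $V$ as an endomorphism with minimal polynomial $q_x(t)\in\mathbb{F}[t]$. $V$ is $x$-cyclic if there is $v\in V$ such that $\{x^k(v)\mid k\geq 0\}$ spans $V$. $V$ is $(x,p)$-cyclic if (1) $V$ is $x$-cyclic, and (2) $q_x(t)\in\mathbb{F}[t^p]$ and $q_x(0)\neq 0$. *)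

theory Defs
  imports
    "HOL-Computational_Algebra.Computational_Algebra"
    "HOL-Library.Set_Algebras"
begin

definition nonsingular_on :: "'a set \<Rightarrow> ('a \<Rightarrow> 'a) \<Rightarrow> bool" where
  "nonsingular_on V f \<longleftrightarrow> bij_betw f V V"

definition finite_order_on :: "'a set \<Rightarrow> ('a \<Rightarrow> 'a) \<Rightarrow> bool" where
  "finite_order_on V f \<longleftrightarrow> (\<exists>n\<ge>1. \<forall>v\<in>V. (f ^^ n) v = v)"

text \<open>The quotient by a subspace \<open>W\<close>, as the set of cosets \<open>a + W\<close>.\<close>

definition quotient_space :: "'a::ab_group_add set \<Rightarrow> 'a set set" where
  "quotient_space W = range (\<lambda>a. a +o W)"

definition direct_sum :: "'a::ab_group_add set \<Rightarrow> nat \<Rightarrow> (nat \<Rightarrow> 'a set) \<Rightarrow> bool" where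
  "direct_sum V n W \<longleftrightarrow>
     V = {\<Sum>i<n. w i | w. \<forall>i<n. w i \<in> W i} \<and>
     (\<forall>w. (\<forall>i<n. w i \<in> W i) \<and> (\<Sum>i<n. w i) = 0 \<longrightarrow> (\<forall>i<n. w i = 0))"

locale lie_algebra = vector_space scale
  for scale :: "'f::field \<Rightarrow> 'l::ab_group_add \<Rightarrow> 'l" +
  fixes bracket :: "'l \<Rightarrow> 'l \<Rightarrow> 'l"
  assumes linear_bracket_right: "Vector_Spaces.linear scale scale (\<lambda>b. bracket a b)"
    and linear_bracket_left: "Vector_Spaces.linear scale scale (\<lambda>a. bracket a b)"
    and bracket_self: "bracket a a = 0"
    and jacobi: "bracket a (bracket b c) + bracket b (bracket c a) + bracket c (bracket a b) = 0"
begin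

text \<open>Sums of cosets are the elementwise sums of Set_Algebras. Adding \<open>W\<close> makes \<open>0 (a + W)\<close> and
  the empty linear combination equal to the coset \<open>W\<close> rather than to \<open>{0}\<close>.\<close>

definition quotient_scale :: "'l set \<Rightarrow> 'f \<Rightarrow> 'l set \<Rightarrow> 'l set" where
  "quotient_scale W c A = scale c ` A + W"

definition quotient_lincomb :: "'l set \<Rightarrow> ('l set \<Rightarrow> 'f) \<Rightarrow> 'l set set \<Rightarrow> 'l set" where
  "quotient_lincomb W c B = (\<Sum>A\<in>B. quotient_scale W (c A) A) + W"

definition quotient_basis :: "'l set \<Rightarrow> 'l set set \<Rightarrow> bool" where
  "quotient_basis W B \<longleftrightarrow>
     finite B \<and> B \<subseteq> quotient_space W \<and>
     (\<forall>A\<in>quotient_space W. \<exists>!c. (\<forall>C. C \<notin> B \<longrightarrow> c C = 0) \<and> A = quotient_lincomb W c B)"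

text \<open>As with \<^const>\<open>dim\<close>, the value is 0 if the quotient is infinite-dimensional.\<close>

definition quotient_dim :: "'l set \<Rightarrow> nat" where
  "quotient_dim W =
     (if \<exists>B. quotient_basis W B then card (SOME B. quotient_basis W B) else 0)"

definition poly_map :: "'f poly \<Rightarrow> ('l \<Rightarrow> 'l) \<Rightarrow> 'l \<Rightarrow> 'l" where
  "poly_map q f v = (\<Sum>i\<le>degree q. scale (coeff q i) ((f ^^ i) v))"

definition annihilates :: "'f poly \<Rightarrow> ('l \<Rightarrow> 'l) \<Rightarrow> 'l set \<Rightarrow> bool" where
  "annihilates q f V \<longleftrightarrow> (\<forall>v\<in>V. poly_map q f v = 0)"

definition minimal_poly :: "('l \<Rightarrow> 'l) \<Rightarrow> 'l set \<Rightarrow> 'f poly" where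
  "minimal_poly f V =
     (THE q. lead_coeff q = 1 \<and> annihilates q f V \<and>
             (\<forall>r. r \<noteq> 0 \<and> annihilates r f V \<longrightarrow> degree q \<le> degree r))"

text \<open>Below, \<open>f\<close> is the action of \<open>x\<close>, so that the submodules for the one-dimensional Lie algebra
  spanned by \<open>x\<close> are the \<open>f\<close>-invariant subspaces.\<close>

definition submodule :: "('l \<Rightarrow> 'l) \<Rightarrow> 'l set \<Rightarrow> bool" where
  "submodule f V \<longleftrightarrow> subspace V \<and> f ` V \<subseteq> V"

definition cyclic :: "('l \<Rightarrow> 'l) \<Rightarrow> 'l set \<Rightarrow> bool" where
  "cyclic f V \<longleftrightarrow> (\<exists>v\<in>V. span (range (\<lambda>k. (f ^^ k) v)) = V)"

text \<open>The polynomials in \<open>t ^ p\<close> are those of the form \<open>r (t ^ p)\<close>.\<close>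

definition p_cyclic :: "nat \<Rightarrow> ('l \<Rightarrow> 'l) \<Rightarrow> 'l set \<Rightarrow> bool" where
  "p_cyclic p f V \<longleftrightarrow>
     cyclic f V \<and>
     (\<exists>r. minimal_poly f V = pcompose r (monom 1 p)) \<and>
     poly (minimal_poly f V) 0 \<noteq> 0"

definition bracket_span :: "'l set \<Rightarrow> 'l set \<Rightarrow> 'l set" where
  "bracket_span A B = span {bracket a b | a b. a \<in> A \<and> b \<in> B}"

definition derived :: "'l set" where
  "derived = bracket_span UNIV UNIV"

definition derived_length_2 :: bool where
  "derived_length_2 \<longleftrightarrow> derived \<noteq> {0} \<and> bracket_span derived derived = {0}"

definition derivation :: "('l \<Rightarrow> 'l) \<Rightarrow> bool" where
  "derivation D \<longleftrightarrow>
     Vector_Spaces.linear scale scale D \<and> (\<forall>a b. D (bracket a b) = bracket (D a) b + bracket a (D b))"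

end

end

theory Submission
  imports Defs
begin

text \<open>
  Write \<open>f\<close> for the action of \<open>x\<close> on \<open>L'\<close>, so that \<open>L = F x + L'\<close>. A non-singular derivation \<open>D\<close>
  satisfies \<open>D x \<in> c x + L'\<close> with \<open>c \<noteq> 0\<close>, hence \<open>D f = c f + f D\<close> on \<open>L'\<close>. For an eigenvalue
  \<open>a \<noteq> 0\<close> and \<open>N = f - a\<close> this gives \<open>N\<^sup>k (D v) = - k c a N\<^sup>k\<^sup>-\<^sup>1 v\<close> whenever \<open>N\<^sup>k v = 0\<close>, so a Jordan
  chain whose length \<open>k\<close> is prime to \<open>p\<close> can be extended. Therefore all Jordan blocks have size
  \<open>p m\<close>, with minimal polynomial \<open>(t - a)\<^sup>p\<^sup>m = (t\<^sup>p - a\<^sup>p)\<^sup>m\<close>.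

  Conversely, on \<open>F[t] / (q)\<close> with \<open>q \<in> F[t\<^sup>p]\<close> the operator \<open>t d/dt + \<mu>\<close> is well defined because
  \<open>q' = 0\<close>, and its commutator with \<open>t\<close> is \<open>t\<close>. Together with \<open>x \<mapsto> x\<close> it yields a derivation whose
  eigenvalues lie in \<open>{1} \<union> (\<mu> + F\<^sub>p)\<close>. If \<open>\<mu>\<^sup>p = \<mu> + 1\<close>, these are roots of unity of order dividing
  \<open>p\<^sup>p - 1\<close>.
\<close>

section \<open>Polynomials in an endomorphism\<close>

context lie_algebra
begin

lemma linear_map_simps:
  assumes "Vector_Spaces.linear scale scale f"
  shows "f (u + v) = f u + f v" "f (scale c u) = scale c (f u)" "f 0 = 0"
    "f (- u) = - f u" "f (u - v) = f u - f v" "f (\<Sum>i\<in>A. h i) = (\<Sum>i\<in>A. f (h i))"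
proof -
  interpret Vector_Spaces.linear scale scale f by (rule assms)
  show "f (u + v) = f u + f v" "f (scale c u) = scale c (f u)" "f 0 = 0"
    "f (- u) = - f u" "f (u - v) = f u - f v" "f (\<Sum>i\<in>A. h i) = (\<Sum>i\<in>A. f (h i))"
    by (auto simp: add scale neg diff sum)
qed

lemmas bracket_right_simps = linear_map_simps[OF linear_bracket_right]
lemmas bracket_left_simps = linear_map_simps[OF linear_bracket_left]

lemma linear_mapI:
  assumes "\<And>u v. f (u + v) = f u + f v" "\<And>c u. f (scale c u) = scale c (f u)"
  shows "Vector_Spaces.linear scale scale f"
  using assms vector_space_axioms by (simp add: Vector_Spaces.linear_iff)

lemma bracket_commute: "bracket a b = - bracket b a"
proof -
  have "bracket a b + bracket b a = bracket (a + b) (a + b)"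
    by (simp only: bracket_right_simps bracket_left_simps) (simp add: bracket_self)
  then show ?thesis
    by (simp add: eq_neg_iff_add_eq_0 bracket_self)
qed

lemma poly_map_eq:
  assumes "degree q \<le> n"
  shows "poly_map q f v = (\<Sum>i\<le>n. scale (coeff q i) ((f ^^ i) v))"
  unfolding poly_map_def
  by (rule sum.mono_neutral_left) (use assms in \<open>auto simp: coeff_eq_0\<close>)

lemma poly_map_0 [simp]: "poly_map 0 f v = 0"
  by (simp add: poly_map_def)

lemma poly_map_add: "poly_map (q + r) f v = poly_map q f v + poly_map r f v"
proof -
  define n where "n = max (degree q) (degree r)"
  have "degree (q + r) \<le> n" "degree q \<le> n" "degree r \<le> n"
    by (auto simp: n_def degree_add_le_max)
  then show ?thesis
    by (simp add: poly_map_eq scale_left_distrib sum.distrib)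
qed

lemma poly_map_smult: "poly_map (smult c q) f v = scale c (poly_map q f v)"
  by (simp add: poly_map_eq[OF degree_smult_le] poly_map_def scale_sum_right)

lemma poly_map_minus: "poly_map (- q) f v = - poly_map q f v"
  using poly_map_smult[of "-1" q f v] by simp

lemma poly_map_diff: "poly_map (q - r) f v = poly_map q f v - poly_map r f v"
  using poly_map_add[of q "- r" f v] by (simp add: poly_map_minus)

lemma poly_map_monom: "poly_map (monom c n) f v = scale c ((f ^^ n) v)"
proof -
  have "poly_map (monom c n) f v = (\<Sum>i\<le>n. scale (if n = i then c else 0) ((f ^^ i) v))"
    by (simp add: poly_map_eq[OF degree_monom_le] coeff_monom)
  also have "\<dots> = (\<Sum>i\<in>{n}. scale (if n = i then c else 0) ((f ^^ i) v))"
    by (rule sum.mono_neutral_right) auto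
  finally show ?thesis by simp
qed

lemma poly_map_closed:
  assumes "submodule f V" "v \<in> V"
  shows "poly_map q f v \<in> V"
proof -
  have "(f ^^ i) v \<in> V" for i
    using assms by (induction i) (auto simp: submodule_def)
  then show ?thesis
    using assms unfolding poly_map_def submodule_def
    by (intro subspace_sum subspace_scale) auto
qed

context
  fixes f :: "'l \<Rightarrow> 'l"
  assumes lin: "Vector_Spaces.linear scale scale f"
begin

lemma poly_map_pCons: "poly_map (pCons a q) f v = scale a v + f (poly_map q f v)"
proof -
  have "poly_map (pCons a q) f v
      = (\<Sum>i\<le>Suc (degree q). scale (coeff (pCons a q) i) ((f ^^ i) v))"
    by (rule poly_map_eq) (simp add: degree_pCons_le)
  also have "\<dots> = scale a v + (\<Sum>i\<le>degree q. scale (coeff q i) ((f ^^ Suc i) v))"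
    by (subst sum.atMost_Suc_shift) simp
  finally show ?thesis
    by (simp add: poly_map_def linear_map_simps[OF lin])
qed

lemma poly_map_linear: "Vector_Spaces.linear scale scale (poly_map q f)"
proof (rule linear_mapI)
  show "poly_map q f (u + v) = poly_map q f u + poly_map q f v" for u v
    by (induction q) (simp_all add: poly_map_pCons linear_map_simps[OF lin] scale_right_distrib)
  show "poly_map q f (scale c u) = scale c (poly_map q f u)" for c u
    by (induction q)
      (simp_all add: poly_map_pCons linear_map_simps[OF lin] scale_right_distrib mult.commute)
qed

lemma poly_map_mult: "poly_map (q * r) f v = poly_map q f (poly_map r f v)"
proof (induction q)
  case (pCons a q)
  then show ?case
    by (simp add: mult_pCons_left poly_map_add poly_map_smult poly_map_pCons)
qed simp

lemma poly_map_commute: "poly_map q f (poly_map r f v) = poly_map r f (poly_map q f v)"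
  by (metis poly_map_mult mult.commute)

lemma poly_map_1 [simp]: "poly_map 1 f v = v"
  by (simp add: poly_map_def)

lemma orbit_span: "span (range (\<lambda>k. (f ^^ k) v)) = range (\<lambda>q. poly_map q f v)"
proof
  have "subspace (range (\<lambda>q. poly_map q f v))"
    by (rule subspaceI)
      (auto simp flip: poly_map_add poly_map_smult intro: image_eqI[of _ _ 0])
  moreover have "range (\<lambda>k. (f ^^ k) v) \<subseteq> range (\<lambda>q. poly_map q f v)"
    using poly_map_monom[of 1 _ f v] by (auto intro: range_eqI[OF sym])
  ultimately show "span (range (\<lambda>k. (f ^^ k) v)) \<subseteq> range (\<lambda>q. poly_map q f v)"
    by (rule span_minimal[rotated])
  show "range (\<lambda>q. poly_map q f v) \<subseteq> span (range (\<lambda>k. (f ^^ k) v))"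
    unfolding poly_map_def by (auto intro!: span_sum span_scale intro: span_base)
qed

text \<open>Polynomials in \<open>f\<close> commute, so whatever kills the generator kills its
  orbit.\<close>

lemma annihilates_orbit_iff:
  "annihilates q f (range (\<lambda>r. poly_map r f v)) \<longleftrightarrow> poly_map q f v = 0"
proof
  assume "annihilates q f (range (\<lambda>r. poly_map r f v))"
  then have "poly_map q f (poly_map 1 f v) = 0"
    by (auto simp: annihilates_def simp del: poly_map_1)
  then show "poly_map q f v = 0" by simp
next
  assume *: "poly_map q f v = 0"
  show "annihilates q f (range (\<lambda>r. poly_map r f v))"
    using * by (auto simp: annihilates_def poly_map_commute[of q]
        linear_map_simps[OF poly_map_linear])
qed

text \<open>Two monic annihilators of the same least degree differ by an annihilator of smaller
  degree, which must vanish; this settles the uniqueness behind \<open>THE\<close>.\<close>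

lemma minimal_poly_eqI:
  assumes "lead_coeff q = 1" "annihilates q f V"
    and min: "\<And>r. r \<noteq> 0 \<Longrightarrow> annihilates r f V \<Longrightarrow> degree q \<le> degree r"
  shows "minimal_poly f V = q"
  unfolding minimal_poly_def
proof (rule the_equality)
  fix q' assume q': "lead_coeff q' = 1 \<and> annihilates q' f V \<and>
      (\<forall>r. r \<noteq> 0 \<and> annihilates r f V \<longrightarrow> degree q' \<le> degree r)"
  have "q \<noteq> 0" "q' \<noteq> 0"
    using assms q' by auto
  then have deg: "degree q' = degree q"
    using assms q' by (meson le_antisym)
  have ann: "annihilates (q' - q) f V"
    using assms(2) q' by (simp add: annihilates_def poly_map_diff)
  show "q' = q"
  proof (rule ccontr)
    assume "q' \<noteq> q"
    then have ne: "q' - q \<noteq> 0" by simp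
    have "degree (q' - q) \<le> degree q"
      using deg by (simp add: degree_diff_le)
    moreover have "coeff (q' - q) (degree q) = 0"
      using assms(1) q' deg by simp
    ultimately have "degree (q' - q) < degree q"
      using ne by (metis leading_coeff_0_iff le_neq_implies_less)
    then show False
      using min[OF ne ann] by simp
  qed
qed (use assms in auto)

text \<open>The description in \<open>minimal_poly\<close> is proper once a nonzero annihilator
  exists: rescale one of least degree to be monic.\<close>

lemma minimal_poly_ex:
  assumes "q0 \<noteq> 0" "annihilates q0 f V"
  shows "lead_coeff (minimal_poly f V) = 1"
    and "annihilates (minimal_poly f V) f V"
    and "r \<noteq> 0 \<Longrightarrow> annihilates r f V \<Longrightarrow> degree (minimal_poly f V) \<le> degree r"
proof -
  obtain q where q: "q \<noteq> 0" "annihilates q f V"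
    and min: "\<And>r. r \<noteq> 0 \<Longrightarrow> annihilates r f V \<Longrightarrow> degree q \<le> degree r"
    using ex_has_least_nat[of "\<lambda>q. q \<noteq> 0 \<and> annihilates q f V" q0 degree] assms by auto
  define m where "m = smult (inverse (lead_coeff q)) q"
  have m: "lead_coeff m = 1" "annihilates m f V" "degree m = degree q"
    using q by (auto simp: m_def annihilates_def poly_map_smult)
  then have "minimal_poly f V = m"
    using min by (intro minimal_poly_eqI) auto
  then show "lead_coeff (minimal_poly f V) = 1" "annihilates (minimal_poly f V) f V"
    "r \<noteq> 0 \<Longrightarrow> annihilates r f V \<Longrightarrow> degree (minimal_poly f V) \<le> degree r"
    using m min by auto
qed

end

end

section \<open>Artin--Schreier shifts of the Euler operator\<close>

text \<open>By the chain rule, the derivative contains the factor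
  \<open>p t^(p-1) = 0\<close>.\<close>

lemma pderiv_pcompose_monom_char:
  "pderiv (pcompose r (monom (1::'a::idom) CHAR('a))) = 0"
  by (simp add: pderiv_pcompose pderiv_monom)

lemma artin_schreier_root_ex:
  assumes "prime p"
  obtains \<mu> :: "'a::alg_closed_field" where "\<mu> ^ p = \<mu> + 1"
proof -
  let ?q = "monom 1 p - [:1, 1:] :: 'a poly"
  have p: "p > 1"
    using assms by (rule prime_gt_1_nat)
  then have "coeff ?q p = 1"
    by (simp add: coeff_pCons split: nat.splits)
  then have "degree ?q \<ge> p"
    by (intro le_degree) simp
  then obtain \<mu> where "poly ?q \<mu> = 0"
    using p alg_closed_imp_poly_has_root[of ?q] by auto
  then have "\<mu> ^ p = \<mu> + 1"
    by (simp add: poly_monom add.commute)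
  then show ?thesis by (rule that)
qed

text \<open>Fermat's little theorem, by additivity of the p-th power map.\<close>

lemma of_nat_power_char:
  assumes "prime p" "CHAR('a::field) = p"
  shows "of_nat m ^ p = (of_nat m :: 'a)"
proof (induction m)
  case 0
  then show ?case
    using assms(1) by (simp add: prime_gt_0_nat)
next
  case (Suc m)
  have "(1 + of_nat m) ^ p = (1 :: 'a) ^ p + of_nat m ^ p"
    using assms by (intro freshmans_dream) auto
  then show ?case
    by (simp add: Suc)
qed

lemma artin_schreier_root_shift:
  fixes \<mu> :: "'a::field"
  assumes p: "prime p" "CHAR('a) = p" and \<mu>: "\<mu> ^ p = \<mu> + 1"
  shows "(\<mu> + of_nat m) ^ p = \<mu> + of_nat m + 1"
proof -
  have "(\<mu> + of_nat m) ^ p = \<mu> ^ p + of_nat m ^ p"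
    using p by (intro freshmans_dream) auto
  then show ?thesis
    by (simp add: \<mu> of_nat_power_char[OF p])
qed

text \<open>Each application of the p-th power map adds 1, so \<open>p\<close> applications return
  to \<mu>, which is nonzero and can be cancelled.\<close>

lemma artin_schreier_root_power:
  fixes \<mu> :: "'a::field"
  assumes p: "prime p" "CHAR('a) = p" and \<mu>: "\<mu> ^ p = \<mu> + 1"
  shows "\<mu> ^ (p ^ p - 1) = 1"
proof -
  have *: "\<mu> ^ (p ^ m) = \<mu> + of_nat m" for m
  proof (induction m)
    case (Suc m)
    have "\<mu> ^ (p ^ Suc m) = (\<mu> ^ (p ^ m)) ^ p"
      by (simp add: mult.commute flip: power_mult)
    then show ?case
      by (simp add: Suc artin_schreier_root_shift[OF p \<mu>])
  qed simp
  have "(of_nat p :: 'a) = 0"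
    using of_nat_CHAR[where 'a = 'a] by (simp only: p(2))
  then have "\<mu> ^ (p ^ p) = \<mu>"
    by (simp add: *)
  moreover have "p ^ p = Suc (p ^ p - 1)"
    using p(1) by (simp add: prime_gt_0_nat)
  ultimately have "\<mu> * \<mu> ^ (p ^ p - 1) = \<mu>"
    by (metis power_Suc)
  moreover have "\<mu> \<noteq> 0"
  proof
    assume "\<mu> = 0"
    with \<mu> have "(0::'a) ^ p = 1" by simp
    moreover have "p \<noteq> 0"
      using p(1) by auto
    ultimately show False by (simp add: power_0_left)
  qed
  ultimately show ?thesis
    by simp
qed

definition shifted_euler :: "'a::field \<Rightarrow> 'a poly \<Rightarrow> 'a poly" where
  "shifted_euler \<mu> r = pCons 0 (pderiv r) + smult \<mu> r"

text \<open>Monomials are eigenvectors, so the linear identities below reduce to comparing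
  coefficients.\<close>

lemma coeff_shifted_euler: "coeff (shifted_euler \<mu> r) j = (\<mu> + of_nat j) * coeff r j"
  by (cases j) (simp_all add: shifted_euler_def coeff_pderiv coeff_pCons algebra_simps)

lemma shifted_euler_add: "shifted_euler \<mu> (r + s) = shifted_euler \<mu> r + shifted_euler \<mu> s"
  by (simp add: poly_eq_iff coeff_shifted_euler algebra_simps)

lemma shifted_euler_diff: "shifted_euler \<mu> (r - s) = shifted_euler \<mu> r - shifted_euler \<mu> s"
  by (simp add: poly_eq_iff coeff_shifted_euler algebra_simps)

lemma shifted_euler_smult: "shifted_euler \<mu> (smult c r) = smult c (shifted_euler \<mu> r)"
  by (simp add: poly_eq_iff coeff_shifted_euler algebra_simps)

text \<open>The commutator with multiplication by \<open>t\<close> is multiplication by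
  \<open>t\<close>; this becomes the Leibniz rule for brackets with \<open>x\<close>.\<close>

lemma shifted_euler_pCons_0: "shifted_euler \<mu> (pCons 0 r) = pCons 0 (shifted_euler \<mu> r + r)"
  by (auto simp add: poly_eq_iff coeff_shifted_euler algebra_simps coeff_pCons split: nat.splits)

text \<open>For \<open>r = q s\<close> the product rule leaves the extra term \<open>t q' s\<close>,
  which vanishes; so the operator descends to \<open>F[t] / (q)\<close>.\<close>

lemma dvd_shifted_euler:
  assumes "q dvd r" "pderiv q = 0"
  shows "q dvd shifted_euler \<mu> r"
proof -
  from assms(1) obtain s where "r = q * s" by auto
  then have "shifted_euler \<mu> r = q * shifted_euler \<mu> s"
    using assms(2) by (simp add: shifted_euler_def pderiv_mult distrib_left)
  then show ?thesis by simp
qed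

text \<open>All eigenvalues \<open>\<mu> + j\<close> are again roots of \<open>t^p = t + 1\<close>,
  hence have order dividing \<open>p^p - 1\<close>.\<close>

lemma shifted_euler_finite_order:
  fixes \<mu> :: "'a::field"
  assumes p: "prime p" "CHAR('a) = p" and \<mu>: "\<mu> ^ p = \<mu> + 1"
  shows "(shifted_euler \<mu> ^^ (p ^ p - 1)) r = r"
proof -
  have "coeff ((shifted_euler \<mu> ^^ n) r) j = (\<mu> + of_nat j) ^ n * coeff r j" for n j
    by (induction n) (simp_all add: coeff_shifted_euler)
  moreover have "(\<mu> + of_nat j) ^ (p ^ p - 1) = 1" for j
    by (rule artin_schreier_root_power[OF p artin_schreier_root_shift[OF p \<mu>]])
  ultimately show ?thesis
    by (simp add: poly_eq_iff)
qed

section \<open>Annihilating polynomials in finite dimension\<close>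

locale fin_dim_lie_algebra = lie_algebra scale bracket + finite_dimensional_vector_space scale Basis
  for scale :: "'f::field \<Rightarrow> 'l::ab_group_add \<Rightarrow> 'l" and bracket Basis
begin

text \<open>The \<open>dimension + 1\<close> iterates \<open>v, f v, ...\<close> are linearly
  dependent, and the relation is the polynomial.\<close>

lemma annihilating_poly_ex:
  obtains q where "q \<noteq> 0" "degree q \<le> dimension" "poly_map q f v = 0"
proof (cases "inj_on (\<lambda>i. (f ^^ i) v) {..dimension}")
  case False
  then obtain i j where ij: "i \<le> dimension" "j \<le> dimension" "i \<noteq> j" "(f ^^ i) v = (f ^^ j) v"
    by (auto simp: inj_on_def)
  \<comment> \<open>Equal iterates collapse in a set of vectors, so their relation is written down
    directly.\<close>
  let ?q = "monom 1 i - monom 1 j :: 'f poly"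
  have "?q \<noteq> 0"
    using ij(3) by (simp add: monom_eq_iff')
  moreover have "degree ?q \<le> dimension"
    using ij by (intro degree_diff_le) (auto intro: order.trans[OF degree_monom_le])
  moreover have "poly_map ?q f v = 0"
    using ij by (simp add: poly_map_diff poly_map_monom)
  ultimately show ?thesis by (rule that)
next
  case True
  let ?S = "(\<lambda>i. (f ^^ i) v) ` {..dimension}"
  have "card ?S = Suc dimension"
    using True by (simp add: card_image)
  then have "dependent ?S"
    using independent_card_le_dim[of ?S UNIV] dim_subset_UNIV[of UNIV] by fastforce
  then obtain u where u: "\<exists>w\<in>?S. u w \<noteq> 0" "(\<Sum>w\<in>?S. scale (u w) w) = 0"
    by (auto simp: dependent_finite)
  define q where "q = (\<Sum>i\<le>dimension. monom (u ((f ^^ i) v)) i)"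
  have coeff_q: "coeff q i = (if i \<le> dimension then u ((f ^^ i) v) else 0)" for i
    by (simp add: q_def coeff_sum)
  have "q \<noteq> 0"
    using u(1) coeff_q by (metis (no_types, lifting) atMost_iff coeff_0 imageE)
  moreover have deg: "degree q \<le> dimension"
    using coeff_q by (intro degree_le) auto
  moreover have "poly_map q f v = 0"
    using u(2) by (simp add: poly_map_eq[OF deg] coeff_q sum.reindex[OF True])
  ultimately show ?thesis by (rule that)
qed

end

section \<open>Derivations from cyclic decompositions\<close>

lemma direct_sum_sum_mem:
  assumes "direct_sum V n W" "\<And>i. i < n \<Longrightarrow> u i \<in> W i"
  shows "(\<Sum>i<n. u i) \<in> V"
proof -
  have "V = {\<Sum>i<n. u i |u. \<forall>i<n. u i \<in> W i}"
    using assms(1) by (simp add: direct_sum_def)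
  then show ?thesis
    using assms(2) by blast
qed

lemma direct_sum_decompose:
  assumes "direct_sum V n W" "v \<in> V"
  obtains u where "v = (\<Sum>i<n. u i)" "\<And>i. i < n \<Longrightarrow> u i \<in> W i"
proof -
  have "V = {\<Sum>i<n. u i |u. \<forall>i<n. u i \<in> W i}"
    using assms(1) by (simp add: direct_sum_def)
  then show ?thesis
    using assms(2) that by blast
qed

lemma direct_sum_zeroD:
  assumes "direct_sum V n W" "\<And>i. i < n \<Longrightarrow> u i \<in> W i" "(\<Sum>i<n. u i) = 0" "i < n"
  shows "u i = 0"
  using conjunct2[OF assms(1)[unfolded direct_sum_def]] assms(2-4) by simp

context fin_dim_lie_algebra
begin

lemma subspace_derived: "subspace derived"
  by (simp add: derived_def bracket_span_def)

lemma bracket_in_derived: "bracket a b \<in> derived"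
  unfolding derived_def bracket_span_def by (rule span_base) auto

lemma submodule_derived: "submodule (bracket a) derived"
  by (auto simp: submodule_def subspace_derived bracket_in_derived)

text \<open>The remainder modulo the minimal polynomial of a polynomial killing \<open>w\<close>
  also kills \<open>w\<close> and has smaller degree, so it is zero.\<close>

lemma cyclic_minimal_poly:
  assumes "Vector_Spaces.linear scale scale f"
    and W: "W = range (\<lambda>r. poly_map r f w)"
  shows "lead_coeff (minimal_poly f W) = 1"
    and "poly_map r f w = 0 \<longleftrightarrow> minimal_poly f W dvd r"
proof -
  note lin = assms(1)
  let ?m = "minimal_poly f W"
  obtain q where "q \<noteq> 0" "poly_map q f w = 0"
    using annihilating_poly_ex by blast
  then have "annihilates q f W"
    by (simp add: W annihilates_orbit_iff[OF lin])
  note m = minimal_poly_ex[OF lin \<open>q \<noteq> 0\<close> this]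
  show "lead_coeff ?m = 1" by (rule m(1))
  have m0: "poly_map ?m f w = 0"
    using m(2) unfolding W annihilates_orbit_iff[OF lin] .
  show "poly_map r f w = 0 \<longleftrightarrow> ?m dvd r"
  proof
    assume r: "poly_map r f w = 0"
    have "poly_map (r mod ?m) f w = 0"
      using r m0 by (simp add: poly_map_diff poly_map_mult[OF lin]
          linear_map_simps[OF poly_map_linear[OF lin]] flip: minus_div_mult_eq_mod)
    then have "annihilates (r mod ?m) f W"
      by (simp add: W annihilates_orbit_iff[OF lin])
    moreover have "?m \<noteq> 0"
      using m(1) by auto
    ultimately have "r mod ?m = 0"
      using m(3)[of "r mod ?m"] degree_mod_less[of ?m r] by fastforce
    then show "?m dvd r" by auto
  next
    assume "?m dvd r"
    then show "poly_map r f w = 0"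
      using m0 by (auto simp: poly_map_mult[OF lin] poly_map_commute[OF lin, of ?m]
          linear_map_simps[OF poly_map_linear[OF lin]])
  qed
qed

end

text \<open>\<open>decomp\<close> and \<open>x_notin\<close> express \<open>dim (L / L') = 1\<close>
  on elements rather than cosets.\<close>

locale metabelian_extension = fin_dim_lie_algebra scale bracket Basis
  for scale :: "'f::field \<Rightarrow> 'l::ab_group_add \<Rightarrow> 'l" and bracket Basis +
  fixes x :: 'l
  assumes abelian: "a \<in> derived \<Longrightarrow> b \<in> derived \<Longrightarrow> bracket a b = 0"
    and x_notin: "x \<notin> derived"
    and decomp: "\<exists>c. \<exists>v\<in>derived. u = scale c x + v"
begin

lemma scale_x_in_derived_iff: "scale c x \<in> derived \<longleftrightarrow> c = 0"
proof
  assume *: "scale c x \<in> derived"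
  show "c = 0"
  proof (rule ccontr)
    assume "c \<noteq> 0"
    then have "x = scale (inverse c) (scale c x)" by simp
    also have "\<dots> \<in> derived"
      by (rule subspace_scale[OF subspace_derived *])
    finally show False
      using x_notin by simp
  qed
qed (simp add: subspace_0[OF subspace_derived])

lemma bracket_decomp:
  assumes "u \<in> derived" "v \<in> derived"
  shows "bracket (scale c x + u) (scale d x + v) = bracket x (scale c v - scale d u)"
  using assms bracket_commute[of u x]
  by (simp add: bracket_right_simps bracket_left_simps bracket_self abelian)

text \<open>\<open>L\<close> is presented as a quotient of \<open>F \<times> F[t]^n\<close>, with
  one polynomial per cyclic generator; the shifted Euler operator acts on the presentation and
  descends to \<open>L\<close>.\<close>

lemma derivation_if_p_cyclic_sum:
  assumes p: "prime p" "CHAR('f) = p"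
    and \<mu>: "(\<mu> :: 'f) ^ p = \<mu> + 1"
    and sum: "direct_sum derived n W"
    and W: "\<And>i. i < n \<Longrightarrow> p_cyclic p (bracket x) (W i)"
  shows "\<exists>D. derivation D \<and> nonsingular_on UNIV D \<and> finite_order_on UNIV D"
proof -
  let ?f = "bracket x"
  let ?T = "shifted_euler \<mu>"
  note lin = linear_bracket_right[of x]
  have "\<forall>i. \<exists>w. i < n \<longrightarrow> W i = range (\<lambda>r. poly_map r ?f w)"
    using W by (metis p_cyclic_def cyclic_def orbit_span[OF lin])
  then obtain w where w: "\<And>i. i < n \<Longrightarrow> W i = range (\<lambda>r. poly_map r ?f (w i))"
    by metis
  \<comment> \<open>The relations of a cyclic summand form the ideal of its minimal polynomial,
    which the operator preserves because that polynomial has derivative zero.\<close>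
  have w_kernel: "poly_map (?T r) ?f (w i) = 0" if i: "i < n" and r: "poly_map r ?f (w i) = 0" for i r
  proof -
    let ?m = "minimal_poly ?f (W i)"
    obtain s where "?m = pcompose s (monom 1 p)"
      using W[OF i] by (auto simp: p_cyclic_def)
    then have "pderiv ?m = 0"
      using p(2) pderiv_pcompose_monom_char[of s] by simp
    then show ?thesis
      using r dvd_shifted_euler[of ?m r \<mu>] cyclic_minimal_poly(2)[OF lin w[OF i]] by simp
  qed

  \<comment> \<open>\<open>\<Psi>\<close> evaluates tuples of polynomials in \<open>L'\<close>,
    \<open>\<Phi>\<close> adds the multiple of \<open>x\<close>, and \<open>T\<close> keeps the
    coefficient of \<open>x\<close>.\<close>
  define \<Psi> where "\<Psi> r = (\<Sum>i<n. poly_map (r i) ?f (w i))" for r :: "nat \<Rightarrow> 'f poly"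
  define \<Phi> where "\<Phi> z = scale (fst z) x + \<Psi> (snd z)" for z :: "'f \<times> (nat \<Rightarrow> 'f poly)"
  define T where "T z = (fst z, ?T \<circ> snd z)" for z :: "'f \<times> (nat \<Rightarrow> 'f poly)"

  have \<Psi>_in: "\<Psi> r \<in> derived" for r
    unfolding \<Psi>_def by (rule direct_sum_sum_mem[OF sum]) (simp add: w)
  have \<Psi>_add: "\<Psi> (\<lambda>i. r i + s i) = \<Psi> r + \<Psi> s" for r s
    by (simp add: \<Psi>_def poly_map_add sum.distrib)
  have \<Psi>_diff: "\<Psi> (\<lambda>i. r i - s i) = \<Psi> r - \<Psi> s" for r s
    by (simp add: \<Psi>_def poly_map_diff sum_subtractf)
  have \<Psi>_smult: "\<Psi> (\<lambda>i. smult c (r i)) = scale c (\<Psi> r)" for c r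
    by (simp add: \<Psi>_def poly_map_smult scale_sum_right)
  have \<Psi>_shift: "\<Psi> (\<lambda>i. pCons 0 (r i)) = bracket x (\<Psi> r)" for r
    by (simp add: \<Psi>_def poly_map_pCons[OF lin] bracket_right_simps)
  \<comment> \<open>Directness splits a relation into relations for the single summands.\<close>
  have \<Psi>_zero: "\<Psi> (?T \<circ> r) = 0" if "\<Psi> r = 0" for r
  proof -
    have "poly_map (r i) ?f (w i) = 0" if "i < n" for i
      using \<open>\<Psi> r = 0\<close> that
      by (intro direct_sum_zeroD[OF sum, where u = "\<lambda>i. poly_map (r i) ?f (w i)"])
        (simp_all add: w \<Psi>_def)
    then show ?thesis
      by (simp add: \<Psi>_def w_kernel)
  qed

  have \<Phi>_surj: "\<exists>z. \<Phi> z = u" for u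
  proof -
    obtain c v where u: "v \<in> derived" "u = scale c x + v"
      using decomp by blast
    obtain ws where ws: "v = (\<Sum>i<n. ws i)" "\<And>i. i < n \<Longrightarrow> ws i \<in> W i"
      using direct_sum_decompose[OF sum u(1)] by blast
    then have "\<forall>i. \<exists>r. i < n \<longrightarrow> ws i = poly_map r ?f (w i)"
      using w by fastforce
    then obtain r where "\<forall>i<n. ws i = poly_map (r i) ?f (w i)"
      by metis
    then have "\<Phi> (c, r) = u"
      using u(2) ws(1) by (simp add: \<Phi>_def \<Psi>_def)
    then show ?thesis by blast
  qed
  \<comment> \<open>Equal images have the same coefficient of \<open>x\<close> since
    \<open>x \<notin> L'\<close>; the difference of the tuples is then a relation.\<close>
  have \<Phi>_T_cong: "\<Phi> (T z) = \<Phi> (T z')" if eq: "\<Phi> z = \<Phi> z'" for z z'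
  proof -
    let ?r = "\<lambda>i. snd z i - snd z' i"
    have *: "scale (fst z - fst z') x = - \<Psi> ?r"
      using eq by (simp add: \<Phi>_def \<Psi>_diff scale_left_diff_distrib algebra_simps)
    then have "scale (fst z - fst z') x \<in> derived"
      by (simp add: \<Psi>_in subspace_neg[OF subspace_derived])
    then have fst: "fst z = fst z'"
      by (simp add: scale_x_in_derived_iff)
    then have "\<Psi> (?T \<circ> ?r) = 0"
      using * by (intro \<Psi>_zero) simp
    then have "\<Psi> (?T \<circ> snd z) = \<Psi> (?T \<circ> snd z')"
      by (simp add: o_def shifted_euler_diff \<Psi>_diff)
    then show ?thesis
      using fst by (simp add: \<Phi>_def T_def)
  qed

  \<comment> \<open>By \<open>\<Phi>_T_cong\<close> the choice of the lift does not matter.\<close>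
  define D where "D u = \<Phi> (T (SOME z. \<Phi> z = u))" for u
  have D: "D (\<Phi> z) = \<Phi> (T z)" for z
    unfolding D_def by (rule \<Phi>_T_cong) (rule someI, rule refl)
  have \<Phi>_bracket: "bracket (\<Phi> z) (\<Phi> z')
      = \<Phi> (0, \<lambda>i. pCons 0 (smult (fst z) (snd z' i) - smult (fst z') (snd z i)))" for z z'
    using bracket_decomp[OF \<Psi>_in \<Psi>_in]
    by (simp add: \<Phi>_def \<Psi>_shift \<Psi>_smult \<Psi>_diff)

  have "derivation D"
    unfolding derivation_def
  proof (intro conjI allI linear_mapI)
    fix u v
    obtain y z where y: "u = \<Phi> y" and z: "v = \<Phi> z"
      using \<Phi>_surj by metis
    have "u + v = \<Phi> (fst y + fst z, \<lambda>i. snd y i + snd z i)"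
      by (simp add: y z \<Phi>_def \<Psi>_add scale_left_distrib)
    then show "D (u + v) = D u + D v"
      by (simp only: D y z)
        (simp add: T_def \<Phi>_def o_def shifted_euler_add \<Psi>_add scale_left_distrib)
  next
    fix c u
    obtain y where y: "u = \<Phi> y"
      using \<Phi>_surj by metis
    have "scale c u = \<Phi> (c * fst y, \<lambda>i. smult c (snd y i))"
      by (simp add: y \<Phi>_def \<Psi>_smult scale_right_distrib)
    then show "D (scale c u) = scale c (D u)"
      by (simp only: D y)
        (simp add: T_def \<Phi>_def o_def shifted_euler_smult \<Psi>_smult scale_right_distrib)
  next
    fix u v
    obtain y z where y: "u = \<Phi> y" and z: "v = \<Phi> z"
      using \<Phi>_surj by metis
    \<comment> \<open>Both sides are compared on lifts; \<open>shifted_euler_pCons_0\<close>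
      supplies the term coming from \<open>D x = x\<close>.\<close>
    show "D (bracket u v) = bracket (D u) v + bracket u (D v)"
      by (simp add: y z D \<Phi>_bracket)
        (simp add: T_def \<Phi>_def o_def shifted_euler_pCons_0 shifted_euler_diff
          shifted_euler_smult \<Psi>_shift \<Psi>_add \<Psi>_diff \<Psi>_smult
          bracket_right_simps)
  qed

  moreover have D_power: "(D ^^ k) (\<Phi> z) = \<Phi> (fst z, \<lambda>i. (?T ^^ k) (snd z i))" for k z
    by (induction k) (simp_all add: D T_def o_def)
  have D_id: "(D ^^ (p ^ p - 1)) u = u" for u
    using \<Phi>_surj[of u] by (auto simp only: D_power shifted_euler_finite_order[OF p \<mu>] prod.collapse)
  \<comment> \<open>The exponent \<open>p^p - 1\<close> has to be positive; the power of
    \<open>D\<close> with one factor fewer is then its inverse.\<close>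
  have "p ^ p > 1"
    using p(1) by (metis one_less_power prime_gt_0_nat prime_gt_1_nat)
  then obtain m where m: "p ^ p - 1 = Suc m"
    by (metis Suc_diff_Suc One_nat_def)
  have D_Suc: "(D ^^ Suc m) u = u" for u
    using D_id by (simp only: m)
  then have "finite_order_on UNIV D"
    unfolding finite_order_on_def by (intro exI[of _ "Suc m"]) simp
  moreover have "nonsingular_on UNIV D"
    unfolding nonsingular_on_def
    by (rule bij_betw_byWitness[where f' = "D ^^ m"])
      (use D_Suc in \<open>auto simp: funpow_swap1\<close>)
  ultimately show ?thesis by blast
qed

end

section \<open>Splitting off Jordan chains\<close>

definition linear_factor :: "'a::field \<Rightarrow> 'a poly" where
  "linear_factor a = [:- a, 1:]"

lemma degree_linear_factor_power [simp]: "degree (linear_factor a ^ k) = k"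
  by (simp add: linear_factor_def degree_linear_power)

lemma lead_coeff_linear_factor_power: "lead_coeff (linear_factor a ^ k) = 1"
  by (simp only: lead_coeff_power) (simp add: linear_factor_def)

lemma linear_factor_power_nonzero [simp]: "linear_factor a ^ k \<noteq> 0"
  by (simp add: linear_factor_def)

text \<open>Additivity of the p-th power map gives \<open>(t - a)^p = t^p + (-a)^p\<close>.\<close>

lemma linear_factor_power_char:
  assumes "prime p" "CHAR('a::field) = p"
  shows "linear_factor (a :: 'a) ^ (p * j) = pcompose ([:(- a) ^ p, 1:] ^ j) (monom 1 p)"
proof -
  have "linear_factor a ^ p = ([:- a:] + monom 1 1) ^ p"
    by (simp add: linear_factor_def monom_altdef)
  also have "\<dots> = [:- a:] ^ p + monom 1 1 ^ p"
    using assms by (intro freshmans_dream) auto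
  also have "\<dots> = pcompose [:(- a) ^ p, 1:] (monom 1 p)"
    by (simp add: pcompose_pCons monom_power poly_const_pow)
  finally have *: "linear_factor a ^ p = pcompose [:(- a) ^ p, 1:] (monom 1 p)" .
  show ?thesis
    unfolding power_mult * by (induction j) (simp_all only: power_0 power_Suc pcompose_mult pcompose_1)
qed

text \<open>Used to append a split-off summand. The closure conditions are elementwise because
  \<open>direct_sum\<close> knows only the additive structure.\<close>

lemma direct_sum_Suc:
  assumes sum: "direct_sum U n W" and "0 \<in> C"
    and UV: "\<And>u. u \<in> U \<Longrightarrow> u \<in> V" and CV: "\<And>c. c \<in> C \<Longrightarrow> c \<in> V"
    and add: "\<And>u v. u \<in> V \<Longrightarrow> v \<in> V \<Longrightarrow> u + v \<in> V"
    and neg: "\<And>u. u \<in> U \<Longrightarrow> - u \<in> U"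
    and decomp: "\<And>v. v \<in> V \<Longrightarrow> \<exists>c\<in>C. v - c \<in> U"
    and int: "\<And>u. u \<in> U \<Longrightarrow> u \<in> C \<Longrightarrow> u = 0"
  shows "direct_sum V (Suc n) (W(n := C))"
proof -
  have split: "(\<Sum>i<n. u i) \<in> U \<and> u n \<in> C \<and> (\<forall>i<n. u i \<in> W i)"
    if "\<forall>i<Suc n. u i \<in> (W(n := C)) i" for u
  proof -
    have "\<forall>i<n. u i \<in> W i" "u n \<in> C"
      using that by (auto simp: less_Suc_eq dest!: spec)
    then show ?thesis
      using direct_sum_sum_mem[OF sum] by blast
  qed
  have "\<exists>u. v = (\<Sum>i<Suc n. u i) \<and> (\<forall>i<Suc n. u i \<in> (W(n := C)) i)"
    if v: "v \<in> V" for v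
  proof -
    obtain c where c: "c \<in> C" "v - c \<in> U"
      using decomp[OF v] by blast
    obtain u where u: "v - c = (\<Sum>i<n. u i)" "\<And>i. i < n \<Longrightarrow> u i \<in> W i"
      using direct_sum_decompose[OF sum c(2)] by blast
    have "v = (\<Sum>i<Suc n. (u(n := c)) i)"
      using u(1) by (simp add: algebra_simps)
    moreover have "\<forall>i<Suc n. (u(n := c)) i \<in> (W(n := C)) i"
      using u(2) c(1) by (simp add: less_Suc_eq)
    ultimately show ?thesis by blast
  qed
  moreover have "(\<Sum>i<Suc n. u i) \<in> V" if "\<forall>i<Suc n. u i \<in> (W(n := C)) i" for u
    using split[OF that] by (simp add: add UV CV)
  moreover have "\<forall>i<Suc n. u i = 0"
    if u: "\<forall>i<Suc n. u i \<in> (W(n := C)) i" and 0: "(\<Sum>i<Suc n. u i) = 0" for u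
  proof -
    note s = split[OF u]
    have "u n = - (\<Sum>i<n. u i)"
      using 0 by (simp add: eq_neg_iff_add_eq_0 add.commute)
    then have un: "u n = 0"
      using s neg int by metis
    then have "(\<Sum>i<n. u i) = 0"
      using 0 by simp
    then have "u i = 0" if "i < n" for i
      using s that by (intro direct_sum_zeroD[OF sum, of u]) auto
    then show ?thesis
      using un by (simp add: less_Suc_eq)
  qed
  ultimately show ?thesis
    unfolding direct_sum_def by blast
qed

context lie_algebra
begin

text \<open>A basis of \<open>S\<close> together with \<open>z\<close> is independent, so the values
  0 on the basis and 1 at \<open>z\<close> extend linearly.\<close>

lemma separating_functional:
  assumes "subspace S" "z \<notin> S"
  obtains \<phi> where "Vector_Spaces.linear scale (*) \<phi>" "\<And>s. s \<in> S \<Longrightarrow> \<phi> s = 0" "\<phi> z = 1"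
proof -
  interpret F: vector_space "(*) :: 'f \<Rightarrow> 'f \<Rightarrow> 'f"
    by unfold_locales (simp_all add: algebra_simps)
  interpret P: vector_space_pair scale "(*) :: 'f \<Rightarrow> 'f \<Rightarrow> 'f"
    by unfold_locales
  obtain B where B: "B \<subseteq> S" "independent B" "S \<subseteq> span B"
    using maximal_independent_subset by blast
  have "span B \<subseteq> S"
    using B(1) assms(1) by (rule span_minimal)
  then have "independent (insert z B)"
    using assms(2) B(2) by (intro independent_insertI) auto
  then obtain \<phi> where \<phi>: "Vector_Spaces.linear scale (*) \<phi>"
    "\<forall>y\<in>insert z B. \<phi> y = (if y = z then 1 else 0)"
    using P.linear_independent_extend[of "insert z B" "\<lambda>y. if y = z then 1 else 0"] by blast
  show ?thesis
  proof
    show "\<phi> s = 0" if "s \<in> S" for s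
    proof (rule P.linear_eq_0_on_span[OF \<phi>(1)])
      show "\<phi> y = 0" if "y \<in> B" for y
        using \<phi>(2) that B(1) assms(2) by auto
      show "s \<in> span B"
        using that B(3) by auto
    qed
  qed (use \<phi> in auto)
qed

context
  fixes f :: "'l \<Rightarrow> 'l"
  assumes lin: "Vector_Spaces.linear scale scale f"
begin

lemma linear_factor_map: "poly_map (linear_factor a) f v = f v - scale a v"
  by (simp add: linear_factor_def poly_map_pCons[OF lin] linear_map_simps[OF lin])

text \<open>Write \<open>r = (t - a)^e s\<close> with \<open>s(a) \<noteq> 0\<close> and
  \<open>e \<le> k\<close>. Multiplying by \<open>(t - a)^(k-e)\<close> gives
  \<open>s(a) (t - a)^k\<close> modulo \<open>(t - a)^(k+1)\<close>, so
  \<open>\<beta> = s(a)\<close>.\<close>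

lemma chain_multiple:
  assumes k: "poly_map (linear_factor a ^ Suc k) f v = 0"
    and r: "\<not> linear_factor a ^ Suc k dvd r"
  obtains m \<beta> where "\<beta> \<noteq> 0"
    "poly_map (linear_factor a ^ m * r) f v = scale \<beta> (poly_map (linear_factor a ^ k) f v)"
proof -
  have "r \<noteq> 0"
    using r by auto
  then obtain s where s: "r = linear_factor a ^ order a r * s" "\<not> linear_factor a dvd s"
    unfolding linear_factor_def using order_decomp by blast
  have e: "order a r \<le> k"
  proof (rule ccontr)
    assume "\<not> order a r \<le> k"
    then have "linear_factor a ^ Suc k dvd linear_factor a ^ order a r"
      by (intro le_imp_power_dvd) simp
    then show False
      using r s(1) by (metis dvd_mult2)
  qed
  have nz: "poly s a \<noteq> 0"
    using s(2) by (simp add: linear_factor_def poly_eq_0_iff_dvd)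
  have "linear_factor a dvd s - [:poly s a:]"
    by (simp add: linear_factor_def flip: poly_eq_0_iff_dvd)
  then obtain t where t: "s - [:poly s a:] = linear_factor a * t" by auto
  then have s_eq: "s = [:poly s a:] + linear_factor a * t"
    by (simp add: algebra_simps)
  have "linear_factor a ^ (k - order a r) * r = linear_factor a ^ k * s"
    by (subst s(1)) (use e in \<open>simp add: mult.assoc[symmetric] flip: power_add\<close>)
  also have "\<dots> = smult (poly s a) (linear_factor a ^ k) + t * linear_factor a ^ Suc k"
    by (subst s_eq) (simp add: algebra_simps)
  finally have "poly_map (linear_factor a ^ (k - order a r) * r) f v
      = scale (poly s a) (poly_map (linear_factor a ^ k) f v)"
    using k by (simp only: poly_map_add poly_map_smult poly_map_mult[OF lin, of t])
      (simp add: linear_map_simps[OF poly_map_linear[OF lin]])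
  then show ?thesis
    by (rule that[OF nz])
qed

text \<open>A nonzero polynomial of degree at most \<open>k\<close> is not divisible by
  \<open>(t - a)^(k+1)\<close>; by \<open>chain_multiple\<close>, if it killed \<open>v\<close> it
  would also kill the end of the chain.\<close>

lemma minimal_poly_chain:
  assumes "poly_map (linear_factor a ^ Suc k) f v = 0" "poly_map (linear_factor a ^ k) f v \<noteq> 0"
  shows "minimal_poly f (range (\<lambda>r. poly_map r f v)) = linear_factor a ^ Suc k"
    and "r \<noteq> 0 \<Longrightarrow> poly_map r f v = 0 \<Longrightarrow> Suc k \<le> degree r"
proof -
  show *: "Suc k \<le> degree r" if r: "r \<noteq> 0" "poly_map r f v = 0" for r
  proof (rule ccontr)
    assume "\<not> Suc k \<le> degree r"
    then have "\<not> linear_factor a ^ Suc k dvd r"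
      using r(1) dvd_imp_degree_le degree_linear_factor_power by metis
    then obtain m \<beta> where "\<beta> \<noteq> 0"
      "poly_map (linear_factor a ^ m * r) f v = scale \<beta> (poly_map (linear_factor a ^ k) f v)"
      using chain_multiple[OF assms(1)] by blast
    then show False
      using r(2) assms(2)
      by (simp add: poly_map_mult[OF lin] linear_map_simps[OF poly_map_linear[OF lin]])
  qed
  show "minimal_poly f (range (\<lambda>r. poly_map r f v)) = linear_factor a ^ Suc k"
  proof (rule minimal_poly_eqI[OF lin lead_coeff_linear_factor_power])
    show "annihilates (linear_factor a ^ Suc k) f (range (\<lambda>r. poly_map r f v))"
      using assms(1) by (simp only: annihilates_orbit_iff[OF lin])
    show "degree (linear_factor a ^ Suc k) \<le> degree r"
      if "r \<noteq> 0" "annihilates r f (range (\<lambda>r. poly_map r f v))" for r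
      unfolding degree_linear_factor_power
      using that by (intro *) (simp_all add: annihilates_orbit_iff[OF lin])
  qed
qed

text \<open>The complement \<open>U\<close> is the common kernel of the functionals \<open>\<phi> \<circ> (f - a)\<^sup>j\<close> with \<open>j \<le> k\<close>, where
  \<open>\<phi>\<close> vanishes on the image of \<open>(f - a)\<^sup>k\<^sup>+\<^sup>1\<close> but not at the end of the chain: the first property
  makes \<open>U\<close> invariant, the second gives the splitting.\<close>

lemma chain_complement:
  assumes V: "submodule f V" "v \<in> V"
    and k: "poly_map (linear_factor a ^ Suc k) f v = 0"
    and top: "\<And>y. y \<in> V \<Longrightarrow>
      poly_map (linear_factor a ^ Suc k) f y \<noteq> poly_map (linear_factor a ^ k) f v"
  obtains U where "submodule f U" "U \<subseteq> V"
    "\<And>u. u \<in> V \<Longrightarrow> \<exists>r. u - poly_map r f v \<in> U"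
    "\<And>r. poly_map r f v \<in> U \<Longrightarrow> poly_map r f v = 0"
proof -
  let ?N = "\<lambda>j. poly_map (linear_factor a ^ j) f"
  note N = linear_map_simps[OF poly_map_linear[OF lin]]
  interpret P: Vector_Spaces.linear scale scale "?N (Suc k)"
    by (rule poly_map_linear[OF lin])
  have sV: "subspace V" and fV: "\<And>u. u \<in> V \<Longrightarrow> f u \<in> V"
    using V by (auto simp: submodule_def)
  have "subspace (?N (Suc k) ` V)"
    by (rule P.subspace_image[OF sV])
  moreover have "?N k v \<notin> ?N (Suc k) ` V"
    using top by force
  ultimately obtain \<phi> where \<phi>: "Vector_Spaces.linear scale (*) \<phi>"
    "\<And>s. s \<in> ?N (Suc k) ` V \<Longrightarrow> \<phi> s = 0" "\<phi> (?N k v) = 1"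
    by (rule separating_functional) auto
  have \<phi>_add: "\<phi> (u + w) = \<phi> u + \<phi> w" and \<phi>_scale: "\<phi> (scale c u) = c * \<phi> u" for u w c
    using \<phi>(1) by (auto simp: Vector_Spaces.linear_iff)
  have \<phi>_0: "\<phi> 0 = 0"
    using \<phi>_scale[of 0] by simp
  have \<phi>_diff: "\<phi> (u - w) = \<phi> u - \<phi> w" for u w
    using \<phi>_add[of "u - w" w] by simp
  have N_high: "?N j v = 0" if "k < j" for j
  proof -
    have "j = (j - Suc k) + Suc k"
      using that by simp
    then obtain e where "j = e + Suc k" ..
    then show ?thesis
      by (simp only: power_add poly_map_mult[OF lin] k N)
  qed
  define U where "U = {u \<in> V. \<forall>j\<le>k. \<phi> (?N j u) = 0}"
  show ?thesis
  proof
    show "U \<subseteq> V" by (auto simp: U_def)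
    have "subspace U"
      using sV by (intro subspaceI)
        (auto simp: U_def N \<phi>_add \<phi>_scale \<phi>_0 subspace_0 subspace_add subspace_scale)
    moreover have "f u \<in> U" if "u \<in> U" for u
    proof -
      \<comment> \<open>Splitting \<open>f\<close> as \<open>(f - a) + a\<close> raises the index by
        at most one, and at index \<open>k + 1\<close> the functional vanishes on the image.\<close>
      have "?N j (f u) = ?N (Suc j) u + scale a (?N j u)" for j
      proof -
        have "?N j (f u) = ?N j (poly_map (linear_factor a) f u + scale a u)"
          by (simp add: linear_factor_map)
        then show ?thesis
          by (simp add: N power_Suc2 poly_map_mult[OF lin] del: power_Suc)
      qed
      moreover have "\<phi> (?N (Suc j) u) = 0" if "j \<le> k" for j
        using \<open>u \<in> U\<close> that \<phi>(2) by (cases "j = k") (auto simp: U_def simp del: power_Suc)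
      ultimately show ?thesis
        using that fV by (auto simp: U_def \<phi>_add \<phi>_scale simp del: power_Suc)
    qed
    ultimately show "submodule f U"
      by (auto simp: submodule_def)
  next
    fix u assume u: "u \<in> V"
    \<comment> \<open>The conditions are met from the top index \<open>k\<close> downwards: a
      multiple of \<open>(t - a)^m\<close> clears index \<open>k - m\<close> because \<phi> is 1 at
      the end of the chain, and leaves higher indices alone because \<open>(f - a)^(k+1)\<close>
      kills \<open>v\<close>.\<close>
    have "\<exists>r. \<forall>j. j \<le> k \<and> k < j + m \<longrightarrow> \<phi> (?N j (u - poly_map r f v)) = 0" for m
    proof (induction m)
      case 0
      show ?case by (rule exI[of _ 0]) linarith
    next
      case (Suc m)
      then obtain r where r: "\<And>j. j \<le> k \<Longrightarrow> k < j + m \<Longrightarrow> \<phi> (?N j (u - poly_map r f v)) = 0"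
        by blast
      define \<beta> where "\<beta> = \<phi> (?N (k - m) (u - poly_map r f v))"
      define r' where "r' = r + smult \<beta> (linear_factor a ^ m)"
      have step: "\<phi> (?N j (u - poly_map r' f v))
          = \<phi> (?N j (u - poly_map r f v)) - \<beta> * \<phi> (?N (j + m) v)" for j
        by (simp add: r'_def poly_map_add poly_map_smult N \<phi>_add \<phi>_scale \<phi>_diff power_add
            poly_map_mult[OF lin] algebra_simps)
      have "\<phi> (?N j (u - poly_map r' f v)) = 0" if j: "j \<le> k" "k < j + Suc m" for j
      proof (cases "k < j + m")
        case True
        then show ?thesis
          using r[OF j(1) True] by (simp add: step N_high \<phi>_0)
      next
        case False
        then have "j + m = k" "k - m = j"
          using j by auto
        then show ?thesis
          using step[of j] \<phi>(3) by (simp add: \<beta>_def)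
      qed
      then show ?case by blast
    qed
    from this[of "Suc k"] obtain r where "\<forall>j\<le>k. \<phi> (?N j (u - poly_map r f v)) = 0"
      by auto
    then have "u - poly_map r f v \<in> U"
      using u V by (auto simp: U_def sV poly_map_closed subspace_diff)
    then show "\<exists>r. u - poly_map r f v \<in> U" by blast
  next
    fix r assume r: "poly_map r f v \<in> U"
    show "poly_map r f v = 0"
    proof (cases "linear_factor a ^ Suc k dvd r")
      case True
      then obtain s where "r = s * linear_factor a ^ Suc k"
        by (metis dvdE mult.commute)
      then show ?thesis
        using k by (simp add: poly_map_mult[OF lin, of s] N del: power_Suc)
    next
      case False
      \<comment> \<open>A nonzero element would have a multiple on which \<phi> takes the value
        \<open>\<beta> \<noteq> 0\<close>, against the conditions defining \<open>U\<close>.\<close>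
      then obtain m \<beta> where m: "\<beta> \<noteq> 0" "poly_map (linear_factor a ^ m * r) f v = scale \<beta> (?N k v)"
        using chain_multiple[OF k] by blast
      then have "\<phi> (?N m (poly_map r f v)) = \<beta>"
        using \<phi>(3) by (simp add: poly_map_mult[OF lin] \<phi>_scale)
      moreover have "\<phi> (?N m (poly_map r f v)) = 0"
      proof (cases "m \<le> k")
        case True
        then show ?thesis
          using r by (simp add: U_def)
      next
        case False
        then have "?N m (poly_map r f v) = 0"
          by (subst poly_map_commute[OF lin]) (simp add: N_high N)
        then show ?thesis
          by (simp add: \<phi>_0)
      qed
      ultimately show ?thesis
        using m(1) by simp
    qed
  qed
qed

end

end

section \<open>Decomposition into cyclic summands\<close>

context fin_dim_lie_algebra
begin

text \<open>Take \<open>q\<close> of least degree killing \<open>v\<close> and a root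
  \<open>a\<close> of \<open>q\<close>: by minimality the cofactor of \<open>t - a\<close> does not
  kill \<open>v\<close>, and its value at \<open>v\<close> is the eigenvector.\<close>

lemma eigenvector_ex:
  assumes alg_closed: "\<And>q :: 'f poly. degree q > 0 \<Longrightarrow> \<exists>z. poly q z = 0"
    and lin: "Vector_Spaces.linear scale scale f"
    and V: "submodule f V" "v \<in> V" "v \<noteq> 0"
  obtains a w where "w \<in> V" "w \<noteq> 0" "f w = scale a w"
proof -
  obtain q0 where "q0 \<noteq> 0" "poly_map q0 f v = 0"
    using annihilating_poly_ex by blast
  then obtain q where q: "q \<noteq> 0" "poly_map q f v = 0"
    and min: "\<And>r. r \<noteq> 0 \<Longrightarrow> poly_map r f v = 0 \<Longrightarrow> degree q \<le> degree r"
    using ex_has_least_nat[of "\<lambda>q. q \<noteq> 0 \<and> poly_map q f v = 0" q0 degree] by auto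
  have "degree q > 0"
  proof (rule ccontr)
    assume "\<not> degree q > 0"
    then obtain c where "q = [:c:]"
      using degree_eq_zeroE by blast
    then show False
      using q V(3) by (simp add: poly_map_pCons[OF lin] linear_map_simps[OF lin])
  qed
  then obtain a where "poly q a = 0"
    using alg_closed by blast
  then obtain r where r: "q = linear_factor a * r"
    unfolding linear_factor_def poly_eq_0_iff_dvd by auto
  have "r \<noteq> 0"
    using q(1) r by auto
  then have "degree q = Suc (degree r)"
    using degree_linear_factor_power[of a 1] linear_factor_power_nonzero[of a 1]
    by (simp add: r degree_mult_eq)
  then have "poly_map r f v \<noteq> 0"
    using min[OF \<open>r \<noteq> 0\<close>] by auto
  moreover have "f (poly_map r f v) = scale a (poly_map r f v)"
    using q(2) by (simp add: r poly_map_mult[OF lin] linear_factor_map[OF lin])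
  moreover have "poly_map r f v \<in> V"
    using V by (simp add: poly_map_closed)
  ultimately show ?thesis
    using that by blast
qed

text \<open>Take a chain of greatest length \<open>k + 1\<close>; a preimage of its end under
  \<open>(f - a)^(k+1)\<close> would start a longer one. Lengths are bounded because an annihilator
  of \<open>v\<close> has at least the degree of the chain length.\<close>

lemma maximal_chain_ex:
  assumes lin: "Vector_Spaces.linear scale scale f"
    and w: "w \<in> V" "w \<noteq> 0" "f w = scale a w"
  obtains k v where "v \<in> V" "poly_map (linear_factor a ^ Suc k) f v = 0"
    "\<And>y. y \<in> V \<Longrightarrow>
      poly_map (linear_factor a ^ Suc k) f y \<noteq> poly_map (linear_factor a ^ k) f v"
proof -
  define P where "P k \<longleftrightarrow> (\<exists>v\<in>V. poly_map (linear_factor a ^ Suc k) f v = 0 \<and>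
      poly_map (linear_factor a ^ k) f v \<noteq> 0)" for k
  have "P 0"
    using w unfolding P_def by (auto simp: linear_factor_map[OF lin] poly_map_1[OF lin])
  moreover have "k \<le> dimension" if "P k" for k
  proof -
    obtain v where v: "poly_map (linear_factor a ^ Suc k) f v = 0"
      "poly_map (linear_factor a ^ k) f v \<noteq> 0"
      using \<open>P k\<close> unfolding P_def by blast
    obtain q where "q \<noteq> 0" "degree q \<le> dimension" "poly_map q f v = 0"
      using annihilating_poly_ex by blast
    then show ?thesis
      using minimal_poly_chain(2)[OF lin v, of q] by linarith
  qed
  ultimately obtain k where k: "P k" "\<And>j. P j \<Longrightarrow> j \<le> k"
    using GreatestI_nat[of P 0 dimension] Greatest_le_nat[of P _ dimension] by metis
  then obtain v where v: "v \<in> V" "poly_map (linear_factor a ^ Suc k) f v = 0"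
    "poly_map (linear_factor a ^ k) f v \<noteq> 0"
    unfolding P_def by blast
  show ?thesis
  proof (rule that[OF v(1,2)])
    fix y assume "y \<in> V"
    show "poly_map (linear_factor a ^ Suc k) f y \<noteq> poly_map (linear_factor a ^ k) f v"
    proof
      assume eq: "poly_map (linear_factor a ^ Suc k) f y = poly_map (linear_factor a ^ k) f v"
      have "poly_map (linear_factor a ^ Suc (Suc k)) f y
          = poly_map (linear_factor a) f (poly_map (linear_factor a ^ Suc k) f y)"
        by (subst power_Suc) (rule poly_map_mult[OF lin])
      also have "\<dots> = 0"
        unfolding eq using v(2) by (simp add: poly_map_mult[OF lin])
      finally have "P (Suc k)"
        unfolding P_def using \<open>y \<in> V\<close> eq v(3) by metis
      then show False
        using k(2) by fastforce
    qed
  qed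
qed

text \<open>The hypothesis \<open>chains\<close> says that no Jordan chain whose length is prime to \<open>p\<close> is maximal.
  Unlike a derivation, it is inherited by the invariant complement of a cyclic summand.\<close>

lemma p_cyclic_decomposition:
  assumes alg_closed: "\<And>q :: 'f poly. degree q > 0 \<Longrightarrow> \<exists>z. poly q z = 0"
    and p: "prime p" "CHAR('f) = p"
    and lin: "Vector_Spaces.linear scale scale f"
    and "submodule f V"
    and "\<And>v. v \<in> V \<Longrightarrow> f v = 0 \<Longrightarrow> v = 0"
    and chains: "\<And>a k v. a \<noteq> 0 \<Longrightarrow> \<not> p dvd Suc k \<Longrightarrow> v \<in> V \<Longrightarrow>
      poly_map (linear_factor a ^ Suc k) f v = 0 \<Longrightarrow>
      \<exists>y\<in>V. poly_map (linear_factor a ^ Suc k) f y = poly_map (linear_factor a ^ k) f v"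
  shows "\<exists>n W. direct_sum V n W \<and> (\<forall>i<n. submodule f (W i) \<and> p_cyclic p f (W i))"
  using assms(5-7)
\<comment> \<open>Split off the cyclic span of a maximal chain and continue with its invariant
  complement.\<close>
proof (induction "dim V" arbitrary: V rule: less_induct)
  case less
  note V = less.prems(1) and inj = less.prems(2) and chains = less.prems(3)
  note map_simps = linear_map_simps[OF poly_map_linear[OF lin]]
  have sV: "subspace V"
    using V by (simp add: submodule_def)
  show ?case
  proof (cases "V = {0}")
    case True
    then have "direct_sum V 0 (\<lambda>_. {})"
      by (simp add: direct_sum_def)
    then show ?thesis by blast
  next
    case False
    then obtain v0 where v0: "v0 \<in> V" "v0 \<noteq> 0"
      using subspace_0[OF sV] by blast
    obtain a w where w: "w \<in> V" "w \<noteq> 0" "f w = scale a w"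
      by (rule eigenvector_ex[OF alg_closed lin V v0])
    then have "a \<noteq> 0"
      using inj by auto
    obtain k v where v: "v \<in> V" "poly_map (linear_factor a ^ Suc k) f v = 0"
      and top: "\<And>y. y \<in> V \<Longrightarrow>
        poly_map (linear_factor a ^ Suc k) f y \<noteq> poly_map (linear_factor a ^ k) f v"
      using maximal_chain_ex[OF lin w] by blast
    \<comment> \<open>Maximality at \<open>y = 0\<close> says that the end of the chain is
      nonzero.\<close>
    have v_k: "poly_map (linear_factor a ^ k) f v \<noteq> 0"
      using top[OF subspace_0[OF sV]] by (simp only: map_simps) metis
    \<comment> \<open>By maximality the conclusion of \<open>chains\<close> fails, which forces the
      length to be a multiple of \<open>p\<close>.\<close>
    have dvd: "p dvd Suc k"
      using chains[OF \<open>a \<noteq> 0\<close> _ v] top by blast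
    define C where "C = range (\<lambda>r. poly_map r f v)"
    have CV: "c \<in> V" if "c \<in> C" for c
      using that poly_map_closed[OF V v(1)] by (auto simp: C_def)
    have "v \<in> C"
      unfolding C_def by (rule range_eqI[of _ _ 1]) (simp add: poly_map_1[OF lin])
    have "submodule f C"
      unfolding submodule_def
    proof
      show "subspace C"
        unfolding C_def orbit_span[OF lin, symmetric] by (rule subspace_span)
      have "f (poly_map r f v) = poly_map (pCons 0 r) f v" for r
        by (simp add: poly_map_pCons[OF lin])
      then show "f ` C \<subseteq> C"
        by (auto simp: C_def)
    qed
    have "p_cyclic p f C"
      unfolding p_cyclic_def
    proof (intro conjI)
      show "cyclic f C"
        using \<open>v \<in> C\<close> unfolding cyclic_def C_def orbit_span[OF lin, symmetric] by blast
      have m: "minimal_poly f C = linear_factor a ^ Suc k"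
        unfolding C_def by (rule minimal_poly_chain[OF lin v(2) v_k])
      obtain j where "Suc k = p * j"
        using dvd by auto
      then show "\<exists>r. minimal_poly f C = pcompose r (monom 1 p)"
        using m linear_factor_power_char[OF p, of a j] by metis
      show "poly (minimal_poly f C) 0 \<noteq> 0"
        using \<open>a \<noteq> 0\<close> by (simp add: m linear_factor_def del: power_Suc)
    qed
    obtain U where U: "submodule f U" "U \<subseteq> V"
      and decomp: "\<And>u. u \<in> V \<Longrightarrow> \<exists>r. u - poly_map r f v \<in> U"
      and int: "\<And>r. poly_map r f v \<in> U \<Longrightarrow> poly_map r f v = 0"
      using chain_complement[OF lin V v top] by blast
    have sU: "subspace U"
      using U by (simp add: submodule_def)
    have "v \<noteq> 0"
      using v_k by (auto simp: map_simps)
    then have "v \<notin> U"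
      using int[of 1] by (auto simp: poly_map_1[OF lin])
    then have "U \<subset> V"
      using U(2) v(1) by auto
    then have "span U \<subset> span V"
      by (simp only: span_eq_iff[THEN iffD2, OF sU] span_eq_iff[THEN iffD2, OF sV])
    then have "dim U < dim V"
      by (rule dim_psubset)
    \<comment> \<open>A preimage \<open>y\<close> in \<open>V\<close> is replaced by its component
      in \<open>U\<close>. The error lies in the cyclic summand and, as a difference of elements of
      \<open>U\<close>, also in \<open>U\<close>; so it is zero.\<close>
    moreover have "\<exists>y\<in>U. poly_map (linear_factor b ^ Suc j) f y = poly_map (linear_factor b ^ j) f u"
      if b: "b \<noteq> 0" "\<not> p dvd Suc j" and u: "u \<in> U" "poly_map (linear_factor b ^ Suc j) f u = 0"
      for b j u
    proof -
      let ?N = "\<lambda>j. poly_map (linear_factor b ^ j) f"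
      obtain y where y: "y \<in> V" "?N (Suc j) y = ?N j u"
        using chains[OF b _ u(2)] u(1) U(2) by blast
      obtain r where r: "y - poly_map r f v \<in> U"
        using decomp[OF y(1)] by blast
      have eq: "?N (Suc j) (y - poly_map r f v)
          = ?N j u - poly_map (linear_factor b ^ Suc j * r) f v"
        by (simp only: map_simps y(2) poly_map_mult[OF lin, of _ r])
      have "poly_map (linear_factor b ^ Suc j * r) f v
          = ?N j u - ?N (Suc j) (y - poly_map r f v)"
        unfolding eq by simp
      also have "\<dots> \<in> U"
        using poly_map_closed[OF U(1)] u(1) r subspace_diff[OF sU] by blast
      finally have "poly_map (linear_factor b ^ Suc j * r) f v = 0"
        by (rule int)
      then show ?thesis
        using r eq by (metis diff_zero)
    qed
    ultimately obtain n W where W: "direct_sum U n W"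
      "\<forall>i<n. submodule f (W i) \<and> p_cyclic p f (W i)"
      using less.hyps[of U] U inj by blast
    have "direct_sum V (Suc n) (W(n := C))"
    proof (rule direct_sum_Suc[OF W(1)])
      show "0 \<in> C"
        using \<open>submodule f C\<close> subspace_0 by (simp add: submodule_def)
      show "\<exists>c\<in>C. u - c \<in> U" if "u \<in> V" for u
        using decomp[OF that] by (auto simp: C_def)
      show "u = 0" if "u \<in> U" "u \<in> C" for u
        using that int by (auto simp: C_def)
    qed (use U(2) CV subspace_add[OF sV] subspace_neg[OF sU] in auto)
    moreover have "\<forall>i<Suc n. submodule f ((W(n := C)) i) \<and> p_cyclic p f ((W(n := C)) i)"
      using W(2) \<open>submodule f C\<close> \<open>p_cyclic p f C\<close> by (simp add: less_Suc_eq)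
    ultimately show ?thesis by blast
  qed
qed

end

section \<open>Chains in the presence of a derivation\<close>

context metabelian_extension
begin

text \<open>\<open>D\<close> preserves \<open>L'\<close> and acts on \<open>L / L'\<close> by some
  \<open>c\<close>; for \<open>c = 0\<close> it would map \<open>L\<close> into \<open>L'\<close>
  and miss \<open>x\<close>. The component of \<open>D x\<close> in \<open>L'\<close> brackets
  trivially with \<open>L'\<close>.\<close>

lemma derivation_action:
  assumes "derivation D" "nonsingular_on UNIV D"
  obtains c where "c \<noteq> 0" "\<And>v. v \<in> derived \<Longrightarrow> D v \<in> derived"
    "\<And>v. v \<in> derived \<Longrightarrow> D (bracket x v) = scale c (bracket x v) + bracket x (D v)"
proof -
  have linD: "Vector_Spaces.linear scale scale D"
    and leibniz: "\<And>a b. D (bracket a b) = bracket (D a) b + bracket a (D b)"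
    using assms(1) by (auto simp: derivation_def)
  have "subspace {v. D v \<in> derived}"
    using subspace_derived
    by (auto simp: subspace_def linear_map_simps[OF linD])
  moreover have "D (bracket a b) \<in> derived" for a b
    using subspace_derived by (simp add: leibniz bracket_in_derived subspace_add)
  ultimately have "span {bracket a b |a b. a \<in> UNIV \<and> b \<in> UNIV} \<subseteq> {v. D v \<in> derived}"
    by (intro span_minimal) auto
  then have D_derived: "D v \<in> derived" if "v \<in> derived" for v
    using that by (auto simp: derived_def bracket_span_def)
  obtain c v0 where Dx: "D x = scale c x + v0" "v0 \<in> derived"
    using decomp by blast
  show ?thesis
  proof
    show "c \<noteq> 0"
    proof
      assume "c = 0"
      have "D u \<in> derived" for u
      proof -
        obtain d v where "u = scale d x + v" "v \<in> derived"
          using decomp by blast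
        then show ?thesis
          using Dx D_derived subspace_derived \<open>c = 0\<close>
          by (simp add: linear_map_simps[OF linD] subspace_add subspace_scale)
      qed
      moreover obtain u where "D u = x"
        using assms(2) by (metis bij_betw_def nonsingular_on_def surjD)
      ultimately show False
        using x_notin by metis
    qed
    show "D (bracket x v) = scale c (bracket x v) + bracket x (D v)" if "v \<in> derived" for v
      using Dx that by (simp add: leibniz bracket_left_simps abelian)
  qed (rule D_derived)
qed

text \<open>Moving \<open>D\<close> past \<open>(f - a)^(k+1)\<close> yields the correction
  \<open>(k+1) c f (f - a)^k v\<close>, and \<open>f\<close> acts as \<open>a\<close> on the end of
  the chain. Up to an invertible scalar, \<open>D v\<close> is the preimage.\<close>

lemma chains_if_derivation:
  assumes p: "CHAR('f) = p"
    and D: "derivation D" "nonsingular_on UNIV D"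
    and "a \<noteq> 0" "\<not> p dvd Suc k" and v: "v \<in> derived"
    and zero: "poly_map (linear_factor a ^ Suc k) (bracket x) v = 0"
  shows "\<exists>y\<in>derived. poly_map (linear_factor a ^ Suc k) (bracket x) y
    = poly_map (linear_factor a ^ k) (bracket x) v"
proof -
  let ?f = "bracket x"
  let ?N = "\<lambda>j. poly_map (linear_factor a ^ j) ?f"
  note lin = linear_bracket_right[of x]
  note map_simps = linear_map_simps[OF poly_map_linear[OF lin]]
  have linD: "Vector_Spaces.linear scale scale D"
    using D(1) by (simp add: derivation_def)
  obtain c where c: "c \<noteq> 0" "\<And>v. v \<in> derived \<Longrightarrow> D v \<in> derived"
    "\<And>v. v \<in> derived \<Longrightarrow> D (?f v) = scale c (?f v) + ?f (D v)"
    using derivation_action[OF D] by blast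
  have N_Suc: "?N (Suc j) u = ?f (?N j u) - scale a (?N j u)" for j u
    by (simp add: poly_map_mult[OF lin] linear_factor_map[OF lin])
  \<comment> \<open>Each factor contributes one summand \<open>c f (f - a)^j v\<close>; stating this
    for \<open>Suc j\<close> avoids a predecessor.\<close>
  have D_N: "D (?N (Suc j) v) = ?N (Suc j) (D v) + scale (of_nat (Suc j) * c) (?f (?N j v))" for j
  proof (induction j)
    case 0
    then show ?case
      using v by (simp add: linear_factor_map[OF lin] poly_map_1[OF lin] linear_map_simps[OF linD] c(3))
  next
    case (Suc j)
    have "?N (Suc j) v \<in> derived"
      by (rule poly_map_closed[OF submodule_derived v])
    then have "D (?N (Suc (Suc j)) v)
        = ?f (D (?N (Suc j) v)) - scale a (D (?N (Suc j) v)) + scale c (?f (?N (Suc j) v))"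
      by (simp only: N_Suc[of "Suc j"] linear_map_simps[OF linD] c(3)) simp
    also have "\<dots> = ?N (Suc (Suc j)) (D v)
        + scale (of_nat (Suc j) * c) (?f (?f (?N j v)) - scale a (?f (?N j v)))
        + scale c (?f (?N (Suc j) v))"
      unfolding Suc N_Suc[of "Suc j"]
      by (simp add: bracket_right_simps scale_right_distrib scale_right_diff_distrib mult.commute)
    also have "?f (?f (?N j v)) - scale a (?f (?N j v)) = ?f (?N (Suc j) v)"
      by (simp only: N_Suc bracket_right_simps)
    moreover have "of_nat (Suc (Suc j)) * c = of_nat (Suc j) * c + c"
      by (simp add: algebra_simps)
    ultimately show ?case
      by (simp only: scale_left_distrib add.assoc)
  qed
  \<comment> \<open>The scalar at \<open>j = k\<close>; it is nonzero because the characteristic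
    does not divide \<open>k + 1\<close>.\<close>
  define s where "s = of_nat (Suc k) * c * a"
  have "(of_nat (Suc k) :: 'f) \<noteq> 0"
    using \<open>\<not> p dvd Suc k\<close> p by (simp only: of_nat_eq_0_iff_char_dvd) simp
  then have "s \<noteq> 0"
    using c(1) \<open>a \<noteq> 0\<close> by (simp add: s_def)
  have "?f (?N k v) = scale a (?N k v)"
    using zero by (simp only: N_Suc) simp
  then have "0 = ?N (Suc k) (D v) + scale s (?N k v)"
    using D_N[of k] unfolding zero by (simp only: linear_map_simps[OF linD] s_def) simp
  then have "?N (Suc k) (D v) = - scale s (?N k v)"
    by (simp only: eq_neg_iff_add_eq_0)
  then have "?N (Suc k) (scale (- inverse s) (D v)) = ?N k v"
    using \<open>s \<noteq> 0\<close> by (simp only: map_simps) simp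
  moreover have "scale (- inverse s) (D v) \<in> derived"
    using c(2)[OF v] subspace_derived by (intro subspace_scale)
  ultimately show ?thesis by blast
qed

end

section \<open>From quotient dimension one to the equivalence\<close>

lemma (in lie_algebra) quotient_dim_1_decomp:
  assumes W: "subspace W" and dim: "quotient_dim W = 1" and x: "x \<notin> W"
  shows "\<exists>c. \<exists>v\<in>W. u = scale c x + v"
proof -
  define B where "B = (SOME B. quotient_basis W B)"
  \<comment> \<open>The value 1 rules out the default 0, so a basis exists.\<close>
  have "\<exists>B. quotient_basis W B" and card: "card B = 1"
    using dim by (auto simp: quotient_dim_def B_def split: if_splits)
  then have B: "quotient_basis W B"
    unfolding B_def by (metis someI_ex)
  obtain A where A: "B = {A}"
    using card card_1_singletonE by blast
  then obtain a where a: "A = a +o W"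
    using B by (auto simp: quotient_basis_def quotient_space_def)
  have *: "\<exists>c. \<exists>v\<in>W. u = scale c a + v" for u
  proof -
    have "u +o W \<in> quotient_space W"
      by (simp add: quotient_space_def)
    then obtain c where "u +o W = quotient_lincomb W c B"
      using B unfolding quotient_basis_def by blast
    moreover have "u \<in> u +o W"
      using subspace_0[OF W] by (force simp: elt_set_plus_def)
    \<comment> \<open>\<open>w1\<close> and \<open>w2\<close> come from the summands
      \<open>+ W\<close> in \<open>quotient_scale\<close> and
      \<open>quotient_lincomb\<close>.\<close>
    ultimately obtain w w1 w2 where w: "w \<in> W" "w1 \<in> W" "w2 \<in> W"
      "u = scale (c A) (a + w) + w1 + w2"
      by (auto simp: A a quotient_lincomb_def quotient_scale_def elt_set_plus_def set_plus_def)
    then have "u = scale (c A) a + (scale (c A) w + w1 + w2)"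
      by (simp add: scale_right_distrib)
    moreover have "scale (c A) w + w1 + w2 \<in> W"
      using w W by (intro subspace_add subspace_scale)
    ultimately show ?thesis by blast
  qed
  \<comment> \<open>Since \<open>x\<close> is not in \<open>W\<close>, its coefficient
    \<open>d\<close> is nonzero and \<open>a\<close> can be exchanged for \<open>x\<close>.\<close>
  obtain d w where x_eq: "w \<in> W" "x = scale d a + w"
    using *[of x] by blast
  then have "d \<noteq> 0"
    using x by auto
  obtain c v where u: "v \<in> W" "u = scale c a + v"
    using *[of u] by blast
  have "u = scale (c / d) x + (v - scale (c / d) w)"
    using \<open>d \<noteq> 0\<close> by (simp add: u x_eq scale_right_distrib)
  moreover have "v - scale (c / d) w \<in> W"
    using u x_eq W by (intro subspace_diff subspace_scale)
  ultimately show ?thesis by blast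
qed

theorem theorem1p2:
  fixes scale :: "'f::alg_closed_field \<Rightarrow> 'l::ab_group_add \<Rightarrow> 'l"
    and bracket :: "'l \<Rightarrow> 'l \<Rightarrow> 'l"
    and p :: nat
    and x :: 'l
  defines "L' \<equiv> lie_algebra.derived scale bracket"
  assumes "prime p" and "CHAR('f) = p"
    and "lie_algebra scale bracket"
    and "\<exists>Basis. finite_dimensional_vector_space scale Basis"
    and "lie_algebra.derived_length_2 scale bracket"
    and "lie_algebra.quotient_dim scale L' = 1"
    and "x \<notin> L'"
    and "nonsingular_on L' (bracket x)"
    and "finite_order_on L' (bracket x)"
  shows "(\<exists>D. lie_algebra.derivation scale bracket D \<and>
              nonsingular_on UNIV D \<and> finite_order_on UNIV D)
         \<longleftrightarrow>
         (\<exists>n W. direct_sum L' n W \<and>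
                (\<forall>i<n. lie_algebra.submodule scale (bracket x) (W i) \<and>
                       lie_algebra.p_cyclic scale p (bracket x) (W i)))"
proof -
  obtain Basis where "finite_dimensional_vector_space scale Basis"
    using assms by blast
  then interpret L: fin_dim_lie_algebra scale bracket Basis
    using \<open>lie_algebra scale bracket\<close> by (intro fin_dim_lie_algebra.intro)
  have L': "L' = L.derived"
    by (simp add: L'_def)
  interpret L: metabelian_extension scale bracket Basis x
  proof
    show "bracket a b = 0" if "a \<in> L.derived" "b \<in> L.derived" for a b
    proof -
      have "bracket a b \<in> L.bracket_span L.derived L.derived"
        unfolding L.bracket_span_def using that by (intro L.span_base) blast
      then show ?thesis
        using \<open>L.derived_length_2\<close> by (simp add: L.derived_length_2_def)
    qed
    show "x \<notin> L.derived"
      using \<open>x \<notin> L'\<close> by (simp add: L')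
    show "\<exists>c. \<exists>v\<in>L.derived. u = scale c x + v" for u
      using L.quotient_dim_1_decomp[OF L.subspace_derived] \<open>L.quotient_dim L' = 1\<close> \<open>x \<notin> L'\<close>
      by (simp add: L')
  qed
  show ?thesis
  proof
    assume "\<exists>D. L.derivation D \<and> nonsingular_on UNIV D \<and> finite_order_on UNIV D"
    then obtain D where D: "L.derivation D" "nonsingular_on UNIV D"
      by blast
    have inj: "v = 0" if "v \<in> L.derived" "bracket x v = 0" for v
    proof -
      have "inj_on (bracket x) L.derived"
        using \<open>nonsingular_on L' (bracket x)\<close> by (simp add: L' nonsingular_on_def bij_betw_def)
      then show ?thesis
        using that L.subspace_0[OF L.subspace_derived] by (auto simp: inj_on_def L.bracket_right_simps)
    qed
    show "\<exists>n W. direct_sum L' n W \<and>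
        (\<forall>i<n. L.submodule (bracket x) (W i) \<and> L.p_cyclic p (bracket x) (W i))"
      unfolding L'
      \<comment> \<open>The derivation supplies the hypothesis on chains; injectivity of the action
        excludes the eigenvalue 0.\<close>
      by (rule L.p_cyclic_decomposition[OF alg_closed_imp_poly_has_root \<open>prime p\<close>
            \<open>CHAR('f) = p\<close> L.linear_bracket_right L.submodule_derived inj])
        (assumption | rule L.chains_if_derivation[OF \<open>CHAR('f) = p\<close> D])+
  next
    assume "\<exists>n W. direct_sum L' n W \<and>
        (\<forall>i<n. L.submodule (bracket x) (W i) \<and> L.p_cyclic p (bracket x) (W i))"
    then obtain n W where W: "direct_sum L.derived n W"
      "\<And>i. i < n \<Longrightarrow> L.p_cyclic p (bracket x) (W i)"
      unfolding L' by blast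
    obtain \<mu> :: 'f where "\<mu> ^ p = \<mu> + 1"
      using artin_schreier_root_ex[OF \<open>prime p\<close>] .
    then show "\<exists>D. L.derivation D \<and> nonsingular_on UNIV D \<and> finite_order_on UNIV D"
      using L.derivation_if_p_cyclic_sum[OF \<open>prime p\<close> \<open>CHAR('f) = p\<close> _ W] by blast
  qed
qed

end
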